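(* Let $\mathcal{A}$ be an $m$-order $n$-dimensional real tensor whose off-diagonal entries are all nonpositive and whose diagonal entries $A_{i\ldots i}$, $1\le i\le n$, are all nonnegative. If $\mathcal{A}$ is strictly diagonally dominant or irreducibly diagonally dominant, then $\mathcal{A}$ is an $M$-tensor.
   Context: Let $m\ge 2$ and $n\ge 1$ be integers. An $m$-order $n$-dimensional (square real) tensor is an array $\mathcal{A}=(A_{i_1\cdots i_m})$ with $A_{i_1\cdots i_m}\in\mathbb{R}$, $1\le i_1,\dots,i_m\le n$. Its diagonal entries are $A_{i\ldots i}$, $1\le i\le n$; all other entries are off-diagonal. It is nonnegative if all its entries are $\ge 0$. The unit tensor $\mathcal{I}$ has entries $\delta_{i_1\ldots i_m}=1$ if $i_1=\cdots=i_m$ and $0$ otherwise. For $x\in\mathbb{C}^n$, $\mathcal{A}x^{m-1}\in\mathbb{C}^n$ has $i$-th component $\sum_{i_2,\ldots,i_m=1}^n A_{ii_2\cdots i_m}x_{i_2}\cdots x_{i_m}$, and $x^{[m-1]}=(x_i^{m-1})_{1\le i\le n}$. A number $\lambda\in\mathbb{C}$ is an eigenvalue of $\mathcal{A}$ with eigenvector $x\in\mathbb{C}^n\setminus\{0\}$ if $\mathcal{A}x^{m-1}=\lambda x^{[m-1]}$. The spectral radius is $\rho(\mathcal{A})=\max\{|\lambda| : \lambda \text{ is an eigenvalue of } \mathcal{A}\}$. $\mathcal{A}$ is an $M$-tensor if there exist a nonnegative tensor $\mathcal{B}$ (of the same order and dimension) and a real number $c>\rho(\mathcal{B})$ such that $\mathcal{A}=c\mathcal{I}-\mathcal{B}$.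 $\mathcal{A}$ is reducible if there is a nonempty proper subset $I\subset\{1,\ldots,n\}$ such that $A_{i_1\cdots i_m}=0$ for all $i_1\in I$ and all $i_2,\ldots,i_m\notin I$; otherwise $\mathcal{A}$ is irreducible. $\mathcal{A}$ is diagonally dominant if for every $i=1,\ldots,n$, $$\sum_{\substack{i_2,\ldots,i_m=1\\ \delta_{ii_2\ldots i_m}=0}}^n |A_{ii_2\ldots i_m}|\le |A_{ii\ldots i}|.$$ It is strictly diagonally dominant if this inequality is strict for all $i$. It is irreducibly diagonally dominant if it is irreducible, diagonally dominant, and the inequality is strict for at least one $i$. *)

theory Defs
  imports "HOL-Analysis.Analysis"
begin

text \<open>
  The dimension of a tensor is the cardinality of the finite index type \<open>'n\<close>; a multi-index
  \<open>(i\<^sub>1, \<dots>, i\<^sub>m)\<close> is a list of length \<open>m\<close>. Since the order \<open>m\<close> is not part of the type, it is an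
  explicit argument below, and only the values on lists of length \<open>m\<close> are meaningful.
\<close>

type_synonym 'n tensor = "'n list \<Rightarrow> real"

definition unit_tensor :: "'n tensor" where
  "unit_tensor is = (if \<forall>i\<in>set is. \<forall>j\<in>set is. i = j then 1 else 0)"

definition nonneg_tensor :: "nat \<Rightarrow> 'n tensor \<Rightarrow> bool" where
  "nonneg_tensor m A \<longleftrightarrow> (\<forall>is. length is = m \<longrightarrow> A is \<ge> 0)"

text \<open>The vector \<open>A x\<^bsup>m-1\<^esup>\<close>; the list \<open>js\<close> stands for \<open>(i\<^sub>2, \<dots>, i\<^sub>m)\<close>.\<close>

definition tensor_apply :: "nat \<Rightarrow> 'n::finite tensor \<Rightarrow> complex ^ 'n \<Rightarrow> complex ^ 'n" where
  "tensor_apply m A x =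
     (\<chi> i. \<Sum>js | length js = m - 1. complex_of_real (A (i # js)) * (\<Prod>j\<leftarrow>js. x $ j))"

definition tensor_eigenvalue :: "nat \<Rightarrow> 'n::finite tensor \<Rightarrow> complex \<Rightarrow> bool" where
  "tensor_eigenvalue m A \<mu> \<longleftrightarrow>
     (\<exists>x. x \<noteq> 0 \<and> tensor_apply m A x = (\<chi> i. \<mu> * (x $ i) ^ (m - 1)))"

text \<open>
  The maximum is taken with \<open>GREATEST\<close> rather than \<open>Max\<close>, because the latter is unspecified on
  sets that are not known to be finite.
\<close>

definition tensor_spectral_radius :: "nat \<Rightarrow> 'n::finite tensor \<Rightarrow> real" where
  "tensor_spectral_radius m A = (GREATEST r. \<exists>\<mu>. tensor_eigenvalue m A \<mu> \<and> r = cmod \<mu>)"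

definition M_tensor :: "nat \<Rightarrow> 'n::finite tensor \<Rightarrow> bool" where
  "M_tensor m A \<longleftrightarrow>
     (\<exists>B c. nonneg_tensor m B \<and> c > tensor_spectral_radius m B \<and>
        (\<forall>is. length is = m \<longrightarrow> A is = c * unit_tensor is - B is))"

definition reducible_tensor :: "nat \<Rightarrow> 'n tensor \<Rightarrow> bool" where
  "reducible_tensor m A \<longleftrightarrow>
     (\<exists>I. I \<noteq> {} \<and> I \<noteq> UNIV \<and>
        (\<forall>i\<in>I. \<forall>js. length js = m - 1 \<and> set js \<inter> I = {} \<longrightarrow> A (i # js) = 0))"

definition irreducible_tensor :: "nat \<Rightarrow> 'n tensor \<Rightarrow> bool" where
  "irreducible_tensor m A \<longleftrightarrow> \<not> reducible_tensor m A"

definition offdiag_row_sum :: "nat \<Rightarrow> 'n::finite tensor \<Rightarrow> 'n \<Rightarrow> real" where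
  "offdiag_row_sum m A i =
     (\<Sum>js | length js = m - 1 \<and> unit_tensor (i # js) = 0. \<bar>A (i # js)\<bar>)"

definition diagonally_dominant :: "nat \<Rightarrow> 'n::finite tensor \<Rightarrow> bool" where
  "diagonally_dominant m A \<longleftrightarrow> (\<forall>i. offdiag_row_sum m A i \<le> \<bar>A (replicate m i)\<bar>)"

definition strictly_diagonally_dominant :: "nat \<Rightarrow> 'n::finite tensor \<Rightarrow> bool" where
  "strictly_diagonally_dominant m A \<longleftrightarrow> (\<forall>i. offdiag_row_sum m A i < \<bar>A (replicate m i)\<bar>)"

definition irreducibly_diagonally_dominant :: "nat \<Rightarrow> 'n::finite tensor \<Rightarrow> bool" where
  "irreducibly_diagonally_dominant m A \<longleftrightarrow>
     irreducible_tensor m A \<and> diagonally_dominant m A \<and>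
     (\<exists>i. offdiag_row_sum m A i < \<bar>A (replicate m i)\<bar>)"

end

theory Submission imports Defs begin

text \<open>
  Write \<open>A = c I - B\<close> with \<open>c\<close> so large that \<open>B\<close> is nonnegative; every row sum of \<open>B\<close> is then at
  most \<open>c\<close>.  Evaluating the eigenvalue equation \<open>B x\<^bsup>m-1\<^esup> = \<mu> x\<^bsup>[m-1]\<^esup>\<close> in a row \<open>i\<close> where
  \<open>\<bar>x\<^sub>i\<bar>\<close> is maximal gives \<open>\<bar>\<mu>\<bar> \<le> c\<close>, with strict inequality if that row is strictly dominant.
  Otherwise irreducibility provides a row in the set \<open>I\<close> of maximal coordinates and a nonzero
  entry all of whose other indices lie outside \<open>I\<close>, and this makes the estimate strict.  The spectral
  radius is an attained maximum: moduli of eigenvalues form a compact set, by restricting to unit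
  eigenvectors, and a nonnegative tensor has an eigenvalue by Brouwer's theorem on the simplex.
\<close>

section \<open>Products over lists\<close>

lemma finite_lists_of_length [simp]: "finite {js :: 'n::finite list. length js = k}"
  using finite_lists_length_eq[of "UNIV :: 'n set" k] by simp

lemma norm_prod_list:
  fixes f :: "'a \<Rightarrow> 'b::real_normed_field"
  shows "norm (\<Prod>j\<leftarrow>js. f j) = (\<Prod>j\<leftarrow>js. norm (f j))"
  by (induction js) (simp_all add: norm_mult)

lemma of_real_prod_list:
  "of_real (\<Prod>j\<leftarrow>js. f j) = (\<Prod>j\<leftarrow>js. of_real (f j) :: 'b::real_field)"
  by (induction js) simp_all

lemma prod_list_scale:
  "(\<Prod>j\<leftarrow>js. c * f j) = c ^ length js * (\<Prod>j\<leftarrow>js. f j :: 'b::comm_monoid_mult)"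
  by (induction js) (simp_all add: ac_simps)

lemma prod_list_nonneg_real:
  fixes f :: "'a \<Rightarrow> real"
  assumes "\<And>j. j \<in> set js \<Longrightarrow> 0 \<le> f j"
  shows "0 \<le> (\<Prod>j\<leftarrow>js. f j)"
  using assms by (induction js) simp_all

lemma prod_list_le_power:
  fixes f :: "'a \<Rightarrow> real"
  assumes "\<And>j. j \<in> set js \<Longrightarrow> 0 \<le> f j" "\<And>j. j \<in> set js \<Longrightarrow> f j \<le> M"
  shows "(\<Prod>j\<leftarrow>js. f j) \<le> M ^ length js"
  using assms
proof (induction js)
  case (Cons a js)
  have "f a * (\<Prod>j\<leftarrow>js. f j) \<le> M * M ^ length js"
    using Cons by (intro mult_mono prod_list_nonneg_real) (auto intro: order_trans)
  then show ?case by simp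
qed simp

text \<open>Strictness comes from the head factor alone: the tail is estimated weakly, since
  \<open>f a\<close> may vanish, and \<open>M ^ length ks\<close> is positive.\<close>

lemma prod_list_less_power:
  fixes f :: "'a \<Rightarrow> real"
  assumes "js \<noteq> []" "\<And>j. j \<in> set js \<Longrightarrow> 0 \<le> f j" "\<And>j. j \<in> set js \<Longrightarrow> f j < M"
  shows "(\<Prod>j\<leftarrow>js. f j) < M ^ length js"
proof -
  obtain a ks where js: "js = a # ks" using assms(1) by (cases js) auto
  have M: "0 < M" using assms(2,3)[of a] js by auto
  have "f a * (\<Prod>j\<leftarrow>ks. f j) \<le> f a * M ^ length ks"
    using assms js by (intro mult_left_mono prod_list_le_power) (auto intro: less_imp_le)
  also have "\<dots> < M * M ^ length ks"
    using assms(3)[of a] M js by (intro mult_strict_right_mono) auto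
  finally show ?thesis using js by simp
qed

lemma continuous_on_prod_list [continuous_intros]:
  fixes f :: "'a \<Rightarrow> 'c::topological_space \<Rightarrow> 'b::real_normed_algebra_1"
  assumes "\<And>j. continuous_on S (f j)"
  shows "continuous_on S (\<lambda>x. \<Prod>j\<leftarrow>js. f j x)"
  by (induction js) (simp_all add: continuous_on_mult assms)

section \<open>The spectral radius is attained\<close>

lemma continuous_on_tensor_apply [continuous_intros]:
  assumes "continuous_on S f"
  shows "continuous_on S (\<lambda>x. tensor_apply m A (f x))"
  unfolding tensor_apply_def by (intro continuous_intros assms)

lemma tensor_apply_scale:
  "tensor_apply m A (\<chi> i. c * x $ i) $ i = c ^ (m - 1) * tensor_apply m A x $ i"
  by (auto simp: tensor_apply_def prod_list_scale sum_distrib_left intro!: sum.cong)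

text \<open>Both sides of the eigenvalue equation are homogeneous of degree \<open>m - 1\<close> in
  the vector, so eigenvectors may be rescaled. The normalisation makes the set of eigenpairs bounded
  and keeps limits of eigenvectors away from \<open>0\<close>.\<close>

lemma tensor_eigenvalue_unit_vector:
  fixes A :: "'n::finite tensor"
  assumes "tensor_eigenvalue m A \<mu>"
  obtains x where "norm x = 1" "tensor_apply m A x = (\<chi> i. \<mu> * (x $ i) ^ (m - 1))"
proof -
  obtain x where x: "x \<noteq> 0" "tensor_apply m A x = (\<chi> i. \<mu> * (x $ i) ^ (m - 1))"
    using assms by (auto simp: tensor_eigenvalue_def)
  define y where "y = (\<chi> i. complex_of_real (1 / norm x) * x $ i)"
  have "y = (1 / norm x) *\<^sub>R x"
    by (simp add: y_def vec_eq_iff scaleR_conv_of_real[where 'a=complex])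
  then have "norm y = 1" using x(1) by simp
  moreover have "tensor_apply m A y = (\<chi> i. \<mu> * (y $ i) ^ (m - 1))"
    unfolding y_def by (simp only: vec_eq_iff tensor_apply_scale x(2) vec_lambda_beta)
      (simp only: power_mult_distrib ac_simps simp_thms)
  ultimately show ?thesis using that by blast
qed

lemma norm_eigenvalue_row_le:
  fixes A :: "'n::finite tensor"
  assumes "tensor_apply m A x = (\<chi> i. \<mu> * (x $ i) ^ (m - 1))"
  shows "cmod \<mu> * cmod (x $ i) ^ (m - 1)
    \<le> (\<Sum>js | length js = m - 1. \<bar>A (i # js)\<bar> * (\<Prod>j\<leftarrow>js. cmod (x $ j)))"
proof -
  have "\<mu> * (x $ i) ^ (m - 1) = tensor_apply m A x $ i" by (simp add: assms)
  then have "cmod \<mu> * cmod (x $ i) ^ (m - 1) = cmod (tensor_apply m A x $ i)"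
    by (metis norm_mult norm_power)
  also have "\<dots> \<le> (\<Sum>js | length js = m - 1. \<bar>A (i # js)\<bar> * (\<Prod>j\<leftarrow>js. cmod (x $ j)))"
    unfolding tensor_apply_def
    by (simp, rule order_trans[OF norm_sum]) (simp add: norm_mult norm_prod_list)
  finally show ?thesis .
qed

lemma vec_max_norm_component:
  fixes x :: "'a::real_normed_vector ^ 'n"
  assumes "x \<noteq> 0"
  obtains i where "\<And>j. norm (x $ j) \<le> norm (x $ i)" "0 < norm (x $ i)"
proof -
  have "Max (range (\<lambda>j. norm (x $ j))) \<in> range (\<lambda>j. norm (x $ j))"
    by (rule Max_in) auto
  then obtain i where i: "norm (x $ i) = Max (range (\<lambda>j. norm (x $ j)))" by (metis imageE)
  have le: "norm (x $ j) \<le> norm (x $ i)" for j unfolding i by (rule Max_ge) auto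
  obtain k where "x $ k \<noteq> 0" using assms by (auto simp: vec_eq_iff)
  then have "0 < norm (x $ i)" using le[of k] by (meson less_le_trans zero_less_norm_iff)
  with le that show ?thesis by blast
qed

text \<open>Gershgorin's argument: in the row of a largest coordinate each product is at most
  \<open>cmod (x $ i) ^ (m - 1)\<close>, which cancels. Summing over all rows removes the dependence
  on \<open>i\<close>; the bound only serves to prove boundedness.\<close>

lemma cmod_tensor_eigenvalue_le:
  fixes A :: "'n::finite tensor"
  assumes "tensor_eigenvalue m A \<mu>"
  shows "cmod \<mu> \<le> (\<Sum>i\<in>UNIV. \<Sum>js | length js = m - 1. \<bar>A (i # js)\<bar>)"
proof -
  obtain x where x: "x \<noteq> 0" "tensor_apply m A x = (\<chi> i. \<mu> * (x $ i) ^ (m - 1))"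
    using assms by (auto simp: tensor_eigenvalue_def)
  obtain i where i: "\<And>j. cmod (x $ j) \<le> cmod (x $ i)" "0 < cmod (x $ i)"
    using vec_max_norm_component[OF x(1)] by blast
  have "cmod \<mu> * cmod (x $ i) ^ (m - 1)
      \<le> (\<Sum>js | length js = m - 1. \<bar>A (i # js)\<bar> * (\<Prod>j\<leftarrow>js. cmod (x $ j)))"
    by (rule norm_eigenvalue_row_le[OF x(2)])
  also have "\<dots> \<le> (\<Sum>js | length js = m - 1. \<bar>A (i # js)\<bar> * cmod (x $ i) ^ (m - 1))"
  proof (intro sum_mono mult_left_mono)
    fix js :: "'n list" assume "js \<in> {js. length js = m - 1}"
    then show "(\<Prod>j\<leftarrow>js. cmod (x $ j)) \<le> cmod (x $ i) ^ (m - 1)"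
      using prod_list_le_power[of js "\<lambda>j. cmod (x $ j)" "cmod (x $ i)"] i(1) by simp
  qed simp
  finally have "cmod \<mu> \<le> (\<Sum>js | length js = m - 1. \<bar>A (i # js)\<bar>)"
    using i(2) by (simp add: sum_distrib_right[symmetric])
  also have "\<dots> \<le> (\<Sum>i\<in>UNIV. \<Sum>js | length js = m - 1. \<bar>A (i # js)\<bar>)"
    by (rule member_le_sum) (auto intro: sum_nonneg)
  finally show ?thesis .
qed

text \<open>\<open>GREATEST\<close> is determined once a maximum exists. The eigenvalues are the
  projection of the compact set \<open>T\<close> of pairs of an eigenvalue and a unit eigenvector,
  and the given eigenvalue makes \<open>T\<close> nonempty.\<close>

lemma tensor_spectral_radius_attained:
  fixes A :: "'n::finite tensor"
  assumes "tensor_eigenvalue m A \<mu>\<^sub>0"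
  obtains \<mu> where "tensor_eigenvalue m A \<mu>" "tensor_spectral_radius m A = cmod \<mu>"
proof -
  define R where "R = (\<Sum>i\<in>UNIV. \<Sum>js | length js = m - 1. \<bar>A (i # js)\<bar>)"
  define T where "T = {p :: complex \<times> (complex ^ 'n). norm (snd p) = 1 \<and>
    tensor_apply m A (snd p) = (\<chi> i. fst p * (snd p $ i) ^ (m - 1))}"
  have ev: "tensor_eigenvalue m A \<mu> \<longleftrightarrow> \<mu> \<in> fst ` T" for \<mu>
  proof
    assume "tensor_eigenvalue m A \<mu>"
    then obtain x where "norm x = 1" "tensor_apply m A x = (\<chi> i. \<mu> * (x $ i) ^ (m - 1))"
      by (rule tensor_eigenvalue_unit_vector)
    then have "(\<mu>, x) \<in> T" by (simp add: T_def)
    then show "\<mu> \<in> fst ` T" by force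
  next
    assume "\<mu> \<in> fst ` T"
    then obtain x where "norm x = 1" "tensor_apply m A x = (\<chi> i. \<mu> * (x $ i) ^ (m - 1))"
      by (auto simp: T_def)
    then show "tensor_eigenvalue m A \<mu>"
      unfolding tensor_eigenvalue_def by (metis norm_zero zero_neq_one)
  qed
  have "closed T"
    unfolding T_def by (intro closed_Collect_conj closed_Collect_eq continuous_intros)
  moreover have "T \<subseteq> cball 0 R \<times> cball 0 1"
  proof
    fix p assume p: "p \<in> T"
    then have "cmod (fst p) \<le> R"
      unfolding R_def using ev by (intro cmod_tensor_eigenvalue_le) blast
    with p show "p \<in> cball 0 R \<times> cball 0 1"
      by (cases p) (simp add: T_def)
  qed
  ultimately have "compact T"
    by (metis bounded_Times bounded_cball bounded_subset compact_eq_bounded_closed)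
  then have "compact ((\<lambda>p. cmod (fst p)) ` T)"
    by (intro compact_continuous_image continuous_intros)
  moreover have "T \<noteq> {}" using assms ev by blast
  ultimately obtain p where p: "p \<in> T" "\<And>q. q \<in> T \<Longrightarrow> cmod (fst q) \<le> cmod (fst p)"
    using compact_attains_sup[of "(\<lambda>p. cmod (fst p)) ` T"] by auto
  have "tensor_spectral_radius m A = cmod (fst p)"
    unfolding tensor_spectral_radius_def using p ev by (intro Greatest_equality) auto
  with p(1) ev that show ?thesis by blast
qed

section \<open>Nonnegative tensors have an eigenvalue\<close>

text \<open>The Perron-Frobenius argument: taking the root of degree \<open>m - 1\<close> turns the
  eigenvalue equation into a fixed point equation up to a scalar, and dividing by the coordinate sum
  \<open>s x\<close> maps the simplex \<open>S\<close> into itself.\<close>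

lemma nonneg_tensor_eigenvalue_exists:
  fixes B :: "'n::finite tensor"
  assumes m: "m \<ge> 2" and B: "nonneg_tensor m B"
  obtains \<mu> where "tensor_eigenvalue m B \<mu>"
proof -
  define S :: "(real ^ 'n) set" where "S = {x. (\<forall>i. 0 \<le> x $ i) \<and> (\<Sum>i\<in>UNIV. x $ i) = 1}"
  define H where "H x i = (\<Sum>js | length js = m - 1. B (i # js) * (\<Prod>j\<leftarrow>js. x $ j))"
    for x :: "real ^ 'n" and i
  text \<open>The summand \<open>x\<^sub>i\<^bsup>m-1\<^esup>\<close> keeps \<open>G x\<close> away from \<open>0\<close>; it shifts the eigenvalue by \<open>1\<close>.\<close>
  define G where "G x i = root (m - 1) (H x i + (x $ i) ^ (m - 1))" for x :: "real ^ 'n" and i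
  define s where "s x = (\<Sum>i\<in>UNIV. G x i)" for x
  define f where "f x = (\<chi> i. G x i / s x)" for x
  have m1: "0 < m - 1" using m by simp
  have H: "0 \<le> H x i" if "x \<in> S" for x i
    unfolding H_def using that B m
    by (intro sum_nonneg mult_nonneg_nonneg prod_list_nonneg_real)
      (auto simp: S_def nonneg_tensor_def)
  have G: "x $ i \<le> G x i" if "x \<in> S" for x i
  proof -
    have x: "0 \<le> x $ i" using that by (simp add: S_def)
    have "x $ i = root (m - 1) ((x $ i) ^ (m - 1))" using m1 x by (simp add: real_root_power_cancel)
    also have "\<dots> \<le> G x i" unfolding G_def using m1 H[OF that] by simp
    finally show ?thesis .
  qed
  have G0: "0 \<le> G x i" if "x \<in> S" for x i
    using G[OF that, of i] that by (auto simp: S_def intro: order_trans)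
  have s: "1 \<le> s x" if "x \<in> S" for x
    unfolding s_def using sum_mono[of UNIV "\<lambda>i. x $ i" "\<lambda>i. G x i"] G[OF that] that
    by (simp add: S_def)
  have "closed S"
  proof -
    have "closed {x :: real ^ 'n. 0 \<le> x $ i}" for i
      by (intro closed_Collect_le continuous_intros)
    moreover have "closed {x :: real ^ 'n. (\<Sum>i\<in>UNIV. x $ i) = 1}"
      by (intro closed_Collect_eq continuous_intros)
    ultimately show ?thesis
      unfolding S_def by (intro closed_Collect_conj closed_Collect_all)
  qed
  moreover have "bounded S"
  proof -
    have "norm x \<le> 1" if "x \<in> S" for x
      using norm_le_l1_cart[of x] that by (simp add: S_def)
    then show ?thesis by (auto simp: bounded_iff)
  qed
  ultimately have "compact S" by (simp add: compact_eq_bounded_closed)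
  moreover have "convex S"
    unfolding convex_def S_def by (auto simp: sum.distrib sum_distrib_left[symmetric])
  moreover have "(\<chi> i. 1 / CARD('n)) \<in> S" by (simp add: S_def)
  then have "S \<noteq> {}" by blast
  moreover have "continuous_on S f"
  proof -
    have "continuous_on S (\<lambda>x. G x i)" for i
      unfolding G_def H_def by (intro continuous_intros)
    moreover have "s x \<noteq> 0" if "x \<in> S" for x using s[OF that] by simp
    ultimately show ?thesis
      unfolding f_def s_def by (intro continuous_intros) auto
  qed
  moreover have "f x \<in> S" if "x \<in> S" for x
  proof -
    have "(\<Sum>i\<in>UNIV. f x $ i) = s x / s x" by (simp add: f_def s_def flip: sum_divide_distrib)
    then show ?thesis using s[OF that] G0[OF that] by (simp add: S_def f_def)
  qed
  ultimately obtain x where x: "x \<in> S" "f x = x"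
    using brouwer[of S f] by blast
  \<comment> \<open>Raising \<open>G x i = s x * x $ i\<close> to the power \<open>m - 1\<close>
    undoes the root; moving the added summand across produces the \<open>- 1\<close>.\<close>
  have eq: "H x i = (s x ^ (m - 1) - 1) * (x $ i) ^ (m - 1)" for i
  proof -
    have "x $ i = G x i / s x" using x(2) by (metis f_def vec_lambda_beta)
    then have "G x i = s x * x $ i" using s[OF x(1)] by simp
    then have "(s x * x $ i) ^ (m - 1) = G x i ^ (m - 1)" by simp
    also have "\<dots> = H x i + (x $ i) ^ (m - 1)"
      unfolding G_def using m1 H[OF x(1), of i] x(1) by (simp add: S_def)
    finally show ?thesis by (simp add: power_mult_distrib algebra_simps)
  qed
  define z where "z = (\<chi> i. complex_of_real (x $ i))"
  have "z \<noteq> 0"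
  proof
    assume "z = 0"
    then have "x $ i = 0" for i by (simp add: z_def vec_eq_iff)
    then show False using x(1) by (simp add: S_def)
  qed
  moreover have "tensor_apply m B z $ i = complex_of_real (H x i)" for i
    by (simp add: tensor_apply_def z_def H_def of_real_prod_list)
  then have "tensor_apply m B z = (\<chi> i. complex_of_real (s x ^ (m - 1) - 1) * (z $ i) ^ (m - 1))"
    by (simp add: vec_eq_iff eq z_def)
  ultimately have "tensor_eigenvalue m B (complex_of_real (s x ^ (m - 1) - 1))"
    unfolding tensor_eigenvalue_def by blast
  then show ?thesis using that by blast
qed

section \<open>Diagonal dominance\<close>

lemma unit_tensor_Cons_eq_0_iff:
  "unit_tensor (i # js) = 0 \<longleftrightarrow> js \<noteq> replicate (length js) i"
proof -
  have "(\<forall>a\<in>set (i # js). \<forall>b\<in>set (i # js). a = b) \<longleftrightarrow> js = replicate (length js) i"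
    by (metis in_set_replicate list.set_intros replicate_length_same set_ConsD)
  then show ?thesis by (simp add: unit_tensor_def)
qed

lemma sum_row_eq_diagonal_plus_offdiagonal:
  fixes F :: "'n::finite list \<Rightarrow> real"
  shows "(\<Sum>js | length js = k. F js)
    = F (replicate k i) + (\<Sum>js | length js = k \<and> unit_tensor (i # js) = 0. F js)"
proof -
  have "{js. length js = k} - {replicate k i} = {js. length js = k \<and> unit_tensor (i # js) = 0}"
    by (auto simp: unit_tensor_Cons_eq_0_iff)
  then show ?thesis
    using sum.remove[of "{js. length js = k}" "replicate k i" F] by simp
qed

text \<open>To be applied to the set \<open>I\<close> of coordinates of maximal modulus. A strictly
  dominant row lies in \<open>I\<close> if all rows are strictly dominant or if
  \<open>I = UNIV\<close>; otherwise \<open>I\<close> is a proper subset, and by irreducibility it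
  cannot witness reducibility.\<close>

lemma dominant_row_or_strict_entry:
  fixes A :: "'n::finite tensor"
  assumes "strictly_diagonally_dominant m A \<or> irreducibly_diagonally_dominant m A" "I \<noteq> {}"
  obtains i where "i \<in> I" "offdiag_row_sum m A i < \<bar>A (replicate m i)\<bar>"
  | i js where "i \<in> I" "length js = m - 1" "set js \<inter> I = {}" "A (i # js) \<noteq> 0"
proof (cases "I = UNIV \<or> strictly_diagonally_dominant m A")
  case True
  then show ?thesis
    using assms that(1)
    unfolding strictly_diagonally_dominant_def irreducibly_diagonally_dominant_def by blast
next
  case False
  then show ?thesis
    using assms that(2)
    unfolding irreducibly_diagonally_dominant_def irreducible_tensor_def reducible_tensor_def
    by blast
qed

theorem theorem3p4:
  fixes A :: "'n::finite tensor" and m :: nat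
  assumes "m \<ge> 2"
    and "\<And>is. length is = m \<Longrightarrow> unit_tensor is = 0 \<Longrightarrow> A is \<le> 0"
    and "\<And>i. A (replicate m i) \<ge> 0"
    and "strictly_diagonally_dominant m A \<or> irreducibly_diagonally_dominant m A"
  shows "M_tensor m A"
proof -
  \<comment> \<open>All diagonal entries are nonnegative, so their sum bounds each of them and the
    diagonal of \<open>B\<close> is nonnegative.\<close>
  define c where "c = (\<Sum>i\<in>UNIV. A (replicate m i))"
  define B where "B is = c * unit_tensor is - A is" for "is"
  have Suc_m: "Suc (m - 1) = m" using assms(1) by simp
  have rep: "i # replicate (m - 1) i = replicate m i" for i :: 'n
    by (metis Suc_m replicate_Suc)
  have unit_diag: "unit_tensor (replicate m i) = 1" for i :: 'n
    by (simp add: unit_tensor_def)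
  have B_off: "B is = \<bar>A is\<bar>" if "length is = m" "unit_tensor is = 0" for "is"
    using assms(2)[OF that] that by (simp add: B_def)
  have B_diag: "B (replicate m i) = c - A (replicate m i)" for i
    by (simp add: B_def unit_diag)
  have B_nonneg: "0 \<le> B is" if len: "length is = m" for "is"
  proof (cases "unit_tensor is = 0")
    case True
    then show ?thesis using B_off[OF len] by simp
  next
    case False
    obtain i js where ijs: "is = i # js" "length js = m - 1"
      using len assms(1) by (cases "is") auto
    then have "js = replicate (m - 1) i"
      using False unit_tensor_Cons_eq_0_iff[of i js] by simp
    with ijs(1) have "is = replicate m i" by (simp only: rep)
    moreover have "A (replicate m i) \<le> c"
      unfolding c_def by (rule member_le_sum) (auto simp: assms(3))
    ultimately show ?thesis using B_diag[of i] by simp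
  qed
  \<comment> \<open>With this formula, diagonal dominance of row \<open>i\<close> of
    \<open>A\<close> says exactly that row \<open>i\<close> of \<open>B\<close> sums to at most
    \<open>c\<close>, and strict dominance that the sum is below \<open>c\<close>.\<close>
  have row: "(\<Sum>js | length js = m - 1. B (i # js)) = c - \<bar>A (replicate m i)\<bar> + offdiag_row_sum m A i"
    for i
  proof -
    have "(\<Sum>js | length js = m - 1 \<and> unit_tensor (i # js) = 0. B (i # js)) = offdiag_row_sum m A i"
      unfolding offdiag_row_sum_def using Suc_m by (intro sum.cong) (auto intro!: B_off)
    then show ?thesis
      using sum_row_eq_diagonal_plus_offdiagonal[of "\<lambda>js. B (i # js)" "m - 1" i] assms(3)[of i]
      unfolding rep B_diag by simp
  qed
  have row_le: "(\<Sum>js | length js = m - 1. B (i # js)) \<le> c" for i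
    using assms(4) unfolding row
    by (auto simp: strictly_diagonally_dominant_def irreducibly_diagonally_dominant_def
        diagonally_dominant_def intro: less_imp_le)
  have small: "cmod \<mu> < c" if ev: "tensor_eigenvalue m B \<mu>" for \<mu>
  proof -
    obtain x where x: "x \<noteq> 0" "tensor_apply m B x = (\<chi> i. \<mu> * (x $ i) ^ (m - 1))"
      using ev by (auto simp: tensor_eigenvalue_def)
    obtain k where k: "\<And>j. cmod (x $ j) \<le> cmod (x $ k)" "0 < cmod (x $ k)"
      using vec_max_norm_component[OF x(1)] by blast
    define M where "M = cmod (x $ k)"
    define I where "I = {i. cmod (x $ i) = M}"
    have M: "0 < M ^ (m - 1)" using k(2) by (simp add: M_def)
    let ?L = "{js :: 'n list. length js = m - 1}"
    let ?p = "\<lambda>js. \<Prod>j\<leftarrow>js. cmod (x $ j)"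
    have entry: "B (i # js) * ?p js \<le> B (i # js) * M ^ (m - 1)" if "js \<in> ?L" for i js
      using that B_nonneg[of "i # js"] Suc_m k(1)
        prod_list_le_power[of js "\<lambda>j. cmod (x $ j)" M]
      by (intro mult_left_mono) (auto simp: M_def)
    \<comment> \<open>The estimate is available in every row of \<open>I\<close>, not only in row
      \<open>k\<close>, so the row can be chosen where strictness is found.\<close>
    have upper: "cmod \<mu> * M ^ (m - 1) \<le> (\<Sum>js\<in>?L. B (i # js) * ?p js)" if "i \<in> I" for i
    proof -
      have "(\<Sum>js\<in>?L. \<bar>B (i # js)\<bar> * ?p js) = (\<Sum>js\<in>?L. B (i # js) * ?p js)"
        using B_nonneg Suc_m by (intro sum.cong) auto
      then show ?thesis
        using norm_eigenvalue_row_le[OF x(2), of i] that by (simp add: I_def)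
    qed
    have total: "(\<Sum>js\<in>?L. B (i # js) * M ^ (m - 1)) = (\<Sum>js\<in>?L. B (i # js)) * M ^ (m - 1)" for i
      by (simp add: sum_distrib_right)
    have "k \<in> I" by (simp add: I_def M_def)
    then have "I \<noteq> {}" by blast
    with assms(4) have "cmod \<mu> * M ^ (m - 1) < c * M ^ (m - 1)"
    proof (cases rule: dominant_row_or_strict_entry)
      case (1 i)
      note upper[OF 1(1)]
      also have "(\<Sum>js\<in>?L. B (i # js) * ?p js) \<le> (\<Sum>js\<in>?L. B (i # js) * M ^ (m - 1))"
        by (intro sum_mono entry)
      \<comment> \<open>Here the strictness comes from the row sum of \<open>B\<close>.\<close>
      also have "\<dots> < c * M ^ (m - 1)"
        unfolding total row using 1(2) M by (intro mult_strict_right_mono) auto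
      finally show ?thesis .
    next
      case (2 i js)
      \<comment> \<open>Here a single summand gives the strictness. Since \<open>i\<close> is in
        \<open>I\<close> and \<open>js\<close> avoids \<open>I\<close>, the entry is off-diagonal,
        so its value in \<open>B\<close> is positive; all coordinates indexed by \<open>js\<close>
        have modulus below \<open>M\<close>. Weak dominance of the row then suffices.\<close>
      have ne: "js \<noteq> []" using 2(2) assms(1) by auto
      have "js \<noteq> replicate (length js) i"
        using 2(1,3) ne by (cases js) auto
      then have "0 < B (i # js)"
        using 2(2,4) Suc_m B_off[of "i # js"] unit_tensor_Cons_eq_0_iff[of i js] by simp
      moreover have "cmod (x $ j) < M" if "j \<in> set js" for j
        using that 2(3) k(1)[of j] by (auto simp: I_def M_def order_less_le)
      then have "?p js < M ^ (m - 1)"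
        using prod_list_less_power[OF ne, of "\<lambda>j. cmod (x $ j)" M] 2(2) by simp
      ultimately have strict: "B (i # js) * ?p js < B (i # js) * M ^ (m - 1)"
        by simp
      note upper[OF 2(1)]
      also have "(\<Sum>js\<in>?L. B (i # js) * ?p js) < (\<Sum>js\<in>?L. B (i # js) * M ^ (m - 1))"
        by (rule sum_strict_mono_ex1) (use entry strict 2(2) in auto)
      also have "\<dots> \<le> c * M ^ (m - 1)"
        unfolding total using row_le M by (intro mult_right_mono) auto
      finally show ?thesis .
    qed
    then show ?thesis using M by simp
  qed
  have nonneg: "nonneg_tensor m B" using B_nonneg by (simp add: nonneg_tensor_def)
  \<comment> \<open>The spectral radius of \<open>B\<close> is the modulus of an actual eigenvalue,
    so the strict bound \<open>small\<close> carries over to it.\<close>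
  obtain \<mu> where "tensor_eigenvalue m B \<mu>" "tensor_spectral_radius m B = cmod \<mu>"
    using nonneg_tensor_eigenvalue_exists[OF assms(1) nonneg] tensor_spectral_radius_attained
    by metis
  then have "tensor_spectral_radius m B < c" using small by simp
  then show ?thesis
    unfolding M_tensor_def using nonneg
    by (intro exI[of _ B] exI[of _ c]) (auto simp: B_def)
qed

end
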